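(* Let $n=4m_2$ with $m_2$ odd, $m_1=2m_2$, $m_0=n$. Let $a\in\mathbb{F}_{2^{m_1}}^*$, $b\in\mathbb{F}_4^*$, $\omega\in\mathbb{F}_{2^{m_1}}^*$; write $\omega=w_2y$ with $w_2\in U_2$, $y\in\mathbb{F}_{2^{m_2}}^*$, and let $\gamma=b\,\psi_{m_1}(w_2)$ and $\alpha=\psi_{m_1}(a)$. Define \[ S_2(a,b,\omega)=\sum_{\substack{u=u_1u_2,\ u_1\in U_1,u_2\in U_2:\\ \mathrm{Tr}^{m_0}_{m_1}(u\omega)\ne0,\ \mathrm{Tr}^{m_0}_{m_2}(u\omega)=0,\ b\,\psi_{m_0}(u_2)=1}}\chi\bigl(\mathrm{Tr}_{m_0}(a u_1^{2^{m_1}-1})\bigr). \] Then \[ S_2(a,b,\omega)=\begin{cases} \frac13\bigl(2^{m_2+1}-2C_{m_1}(a,a)-K_{m_1}(a)\bigr)&\text{if }\gamma=\alpha\text{ and }\gamma=\alpha^{-1},\\ \frac13\bigl(-2^{m_2}-2C_{m_1}(a,a)-K_{m_1}(a)\bigr)&\text{if }\gamma=\alpha\text{ and }\gamma\ne\alpha^{-1},\\ \frac13\bigl(2^{m_2+1}+C_{m_1}(a,a)-K_{m_1}(a)\bigr)&\text{if }\gamma\ne\alpha\text{ and }\gamma=\alpha^{-1},\\ \frac13\bigl(-2^{m_2}+C_{m_1}(a,a)-K_{m_1}(a)\bigr)&\text{if }\gamma\ne\alpha\text{ and }\gamma\ne\alpha^{-1}. \end{cases} \]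
   Context: For $k\mid l$, $\mathrm{Tr}_k^l$ is the relative trace $\mathbb{F}_{2^l}\to\mathbb{F}_{2^k}$, $x\mapsto\sum_{j=0}^{l/k-1}x^{2^{kj}}$, and $\mathrm{Tr}_l=\mathrm{Tr}_1^l$. $\chi(x)=(-1)^x$ for $x\in\mathbb{F}_2$. $U_1\subset\mathbb{F}_{2^{m_0}}^*$ is the group of $(2^{m_1}+1)$-th roots of unity and $U_2\subset\mathbb{F}_{2^{m_1}}^*$ the group of $(2^{m_2}+1)$-th roots of unity. For $i\in\{0,1\}$, $\psi_{m_i}(x)=x^{(2^{m_i}-1)/3}\in\mathbb{F}_4$. Kloosterman sum: $K_{m_1}(a)=\sum_{x\in\mathbb{F}_{2^{m_1}}}\chi(\mathrm{Tr}_{m_1}(ax+x^{-1}))$ with $0^{-1}=0$. Cubic sum: $C_{m_1}(a,b)=\sum_{x\in\mathbb{F}_{2^{m_1}}}\chi(\mathrm{Tr}_{m_1}(ax^3+bx))$. *)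

theory Defs
  imports Complex_Main "HOL-Number_Theory.Number_Theory" "HOL-Computational_Algebra.Polynomial"
begin

text \<open>
  All fields live inside one finite field \<^typ>\<open>'a\<close> of order $2^{m_0}$. For $k \mid m_0$ the subfield
  of order $2^k$ is the set of fixed points of $x \mapsto x^{2^k}$ (see \<open>card_GF2\<close> below).
\<close>

definition GF2 :: "nat \<Rightarrow> 'a::finite_field set" where
  "GF2 k = {x. x ^ (2 ^ k) = x}"

definition GF2_star :: "nat \<Rightarrow> 'a::finite_field set" where
  "GF2_star k = GF2 k - {0}"

definition rel_trace :: "nat \<Rightarrow> nat \<Rightarrow> 'a::finite_field \<Rightarrow> 'a" where
  "rel_trace k l x = (\<Sum>j<l div k. x ^ (2 ^ (k * j)))"

abbreviation abs_trace :: "nat \<Rightarrow> 'a::finite_field \<Rightarrow> 'a" where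
  "abs_trace l \<equiv> rel_trace 1 l"

text \<open>Only applied to elements of the prime field $\{0, 1\}$.\<close>

definition chi :: "'a::finite_field \<Rightarrow> real" where
  "chi x = (if x = 0 then 1 else -1)"

definition roots_of_unity_in :: "nat \<Rightarrow> nat \<Rightarrow> 'a::finite_field set" where
  "roots_of_unity_in k d = {x \<in> GF2_star k. x ^ d = 1}"

definition psi :: "nat \<Rightarrow> 'a::finite_field \<Rightarrow> 'a" where
  "psi m x = x ^ ((2 ^ m - 1) div 3)"

text \<open>The library convention \<^prop>\<open>inverse 0 = (0::'a::finite_field)\<close> is the one required here.\<close>

definition kloosterman_sum :: "nat \<Rightarrow> 'a::finite_field \<Rightarrow> real" where
  "kloosterman_sum m a = (\<Sum>x\<in>GF2 m. chi (abs_trace m (a * x + inverse x)))"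

definition cubic_sum :: "nat \<Rightarrow> 'a::finite_field \<Rightarrow> 'a \<Rightarrow> real" where
  "cubic_sum m a b = (\<Sum>x\<in>GF2 m. chi (abs_trace m (a * x ^ 3 + b * x)))"

text \<open>
  The sum over $u = u_1 u_2$ is indexed by the pairs $(u_1, u_2) \in U_1 \times U_2$: the orders
  $2^{m_1}+1$ and $2^{m_2}+1$ are coprime for $m_1 = 2 m_2$, so $u$ determines the pair.
\<close>

definition S2 :: "nat \<Rightarrow> nat \<Rightarrow> nat \<Rightarrow> 'a::finite_field \<Rightarrow> 'a \<Rightarrow> 'a \<Rightarrow> real" where
  "S2 m0 m1 m2 a b \<omega> =
     (\<Sum>(u1, u2) \<in> {(u1, u2).
          u1 \<in> roots_of_unity_in m0 (2 ^ m1 + 1) \<and>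
          u2 \<in> roots_of_unity_in m1 (2 ^ m2 + 1) \<and>
          rel_trace m1 m0 (u1 * u2 * \<omega>) \<noteq> 0 \<and>
          rel_trace m2 m0 (u1 * u2 * \<omega>) = 0 \<and>
          b * psi m0 u2 = 1}.
        chi (abs_trace m0 (a * u1 ^ (2 ^ m1 - 1))))"

lemma card_GF2:
  assumes card: "card (UNIV :: 'a::finite_field set) = 2 ^ n" and "k dvd n" "k > 0" "n > 0"
  shows "card (GF2 k :: 'a set) = 2 ^ k"
proof -
  define f :: "nat \<Rightarrow> 'a poly" where "f j = monom 1 (2 ^ j) - monom 1 1" for j
  obtain d where d: "n = k * d" using \<open>k dvd n\<close> by blast
  have deg: "degree (f j) = 2 ^ j" if "j > 0" for j
  proof -
    have "(1::nat) < 2 ^ j" using that by (intro one_less_power) auto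
    then have "degree (- monom (1::'a) 1) < degree (monom (1::'a) (2 ^ j))"
      by (simp add: degree_monom_eq)
    from degree_add_eq_left[OF this] show ?thesis
      by (simp add: f_def degree_monom_eq)
  qed
  have roots: "{x. poly (f j) x = 0} = GF2 j" for j
    by (auto simp: f_def GF2_def poly_monom)
  have dvd: "f k dvd f (k * i)" for i
  proof (induction i)
    case 0
    then show ?case by (simp add: f_def)
  next
    case (Suc i)
    have eq: "f (k * Suc i) = (monom 1 (2 ^ (k * i)) ^ (2 ^ k) - monom 1 1 ^ (2 ^ k)) + f k"
      by (simp only: f_def monom_power power_one mult_1 mult_Suc_right power_add diff_add_cancel
        add_diff_eq mult.commute[of "2 ^ (k * i)"])
    have "f (k * i) dvd monom 1 (2 ^ (k * i)) ^ (2 ^ k) - monom 1 1 ^ (2 ^ k)"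
      unfolding f_def by (subst power_diff_sumr2) simp
    then show ?case
      unfolding eq by (rule dvd_add[OF dvd_trans[OF Suc] dvd_refl])
  qed
  from dvd[of d, folded d] obtain g where g: "f n = f k * g" by (rule dvdE)
  have fn: "f n \<noteq> 0" "f k \<noteq> 0" using deg[OF \<open>n > 0\<close>] deg[OF \<open>k > 0\<close>] by fastforce+
  have "g \<noteq> 0" using fn(1) unfolding g by simp
  have "degree g + 2 ^ k = 2 ^ n"
    using deg[OF \<open>n > 0\<close>] deg[OF \<open>k > 0\<close>] degree_mult_eq[OF fn(2) \<open>g \<noteq> 0\<close>]
    unfolding g by linarith
  moreover
  have "GF2 n = (UNIV :: 'a set)"
    using finite_field_power_card_eq_same[where ?'a = 'a] card by (auto simp: GF2_def)
  then have "card ({x. poly (f k) x = 0} \<union> {x. poly g x = 0}) = 2 ^ n"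
    using roots[of n] card unfolding g by (simp add: Collect_disj_eq)
  moreover have "card {x. poly g x = 0} \<le> degree g"
    using \<open>g \<noteq> 0\<close> by (rule card_poly_roots_bound)
  moreover have "card {x. poly (f k) x = 0} \<le> 2 ^ k"
    using card_poly_roots_bound[OF fn(2)] deg[OF \<open>k > 0\<close>] by simp
  moreover have "card ({x. poly (f k) x = 0} \<union> {x. poly g x = 0})
      \<le> card {x. poly (f k) x = 0} + card {x. poly g x = 0}"
    by (rule card_Un_le)
  ultimately have "card {x. poly (f k) x = 0} = 2 ^ k"
    by linarith
  then show ?thesis by (simp add: roots)
qed

end

theory Submission
  imports Defs
begin

text \<open>
  Write $q = 2^{m_2}$, $Q = q^2$ and $t = u_1 + u_1^{-1}$. By the polar decomposition
  $\mathbb{F}_Q^* = U_2 \cdot \mathbb{F}_q^*$ the trace conditions leave exactly one $u_2$ for each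
  $u_1 \neq 1$, and the condition on $\psi_{m_0}(u_2)$ becomes $\gamma \psi_{m_1}(t) = 1$. As $t$ runs
  twice through the elements of $\mathbb{F}_Q^*$ with $\mathrm{Tr}(1/t) = 1$, the sum is
  \[ \sum_{\psi(s) = \gamma} \chi(\mathrm{Tr}(as)) - \sum_{\psi(s) = \gamma} \chi(\mathrm{Tr}(as + s^{-1})). \]
  The first sum is a semiprimitive cubic Gauss period. With $a = c^2$ the second one is
  $\sum \chi(\mathrm{Tr}(c(s + s^{-1})))$ over a coset of the cubes; the coset of cubes is evaluated by
  comparing $\mathbb{F}_Q^*$ with $U_1$, and the other two cosets are exchanged by $s \mapsto s^{-1}$.
\<close>

section \<open>Fibres of power maps\<close>

lemma sum_comp_const_fibres:
  fixes g :: "'b \<Rightarrow> real"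
  assumes "finite A" "finite B" "f ` A \<subseteq> B" "\<And>y. y \<in> B \<Longrightarrow> card {x \<in> A. f x = y} = k"
  shows "(\<Sum>x\<in>A. g (f x)) = real k * (\<Sum>y\<in>B. g y)"
proof -
  have "(\<Sum>x\<in>A. g (f x)) = (\<Sum>y\<in>B. \<Sum>x\<in>{x \<in> A. f x = y}. g (f x))"
    using assms(1-3) by (rule sum.group[symmetric])
  also have "\<dots> = (\<Sum>y\<in>B. real k * g y)"
    using assms(4) by (intro sum.cong) auto
  finally show ?thesis by (simp add: sum_distrib_left)
qed

lemma card_power_eq_le:
  fixes y :: "'a::idom"
  assumes "d > 0"
  shows "finite {x. x ^ d = y}" "card {x. x ^ d = y} \<le> d"
proof -
  define p where "p = monom (1::'a) d + [:- y:]"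
  have "degree [:- y:] < degree (monom (1::'a) d)"
    using assms by (simp add: degree_monom_eq)
  from degree_add_eq_left[OF this] have deg: "degree p = d"
    by (simp add: p_def degree_monom_eq)
  then have "p \<noteq> 0" using assms by auto
  moreover have "{x. x ^ d = y} = {x. poly p x = 0}"
    by (simp add: p_def poly_monom)
  ultimately show "finite {x. x ^ d = y}" "card {x. x ^ d = y} \<le> d"
    using poly_roots_finite card_poly_roots_bound deg by fastforce+
qed

text \<open>
  The fibres of the $d$-th power map on the $de$-th roots of unity have at most $d$ elements, and
  there are at most $e$ of them, so if all $de$ roots exist, both bounds are attained.
\<close>

lemma card_power_eq:
  fixes y :: "'a::idom"
  assumes N: "card {x::'a. x ^ (d * e) = 1} = d * e" and pos: "d > 0" "e > 0" and y: "y ^ e = 1"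
  shows "card {x. x ^ d = y} = d"
proof -
  let ?A = "{x::'a. x ^ (d * e) = 1}" and ?B = "{z::'a. z ^ e = 1}"
  have fin: "finite ?A" "finite ?B" and B: "card ?B \<le> e"
    using card_power_eq_le[of "d * e" "1::'a"] card_power_eq_le[of e "1::'a"] pos by auto
  have fib: "{x \<in> ?A. x ^ d = z} = {x. x ^ d = z}" if "z \<in> ?B" for z
    using that by (auto simp: power_mult)
  have le: "card {x. x ^ d = z} \<le> d" for z :: 'a
    using card_power_eq_le pos by auto
  have sub: "(\<lambda>x. x ^ d) ` ?A \<subseteq> ?B" by (auto simp: power_mult)
  have "card ?A = (\<Sum>z\<in>?B. card {x \<in> ?A. x ^ d = z})"
    using sum.group[OF fin sub, of "\<lambda>_. 1::nat"] by simp
  then have eq: "d * e = (\<Sum>z\<in>?B. card {x. x ^ d = z})"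
    using N fib by simp
  moreover have "(\<Sum>z\<in>?B. card {x. x ^ d = z}) \<le> (\<Sum>z\<in>?B. d)"
    by (intro sum_mono le)
  moreover have "(\<Sum>z\<in>?B. d) \<le> d * e" using B by simp
  ultimately have "(\<Sum>z\<in>?B. card {x. x ^ d = z}) = (\<Sum>z\<in>?B. d)" by linarith
  from sum_mono_inv[OF this, of y] show ?thesis using le fin y by simp
qed

text \<open>If \<open>u\<close> inverts \<open>d\<close> modulo \<open>n\<close>, raising to the
  power \<open>u\<close> undoes the \<open>d\<close>-th power on \<open>S\<close>.\<close>

lemma inj_on_power_coprime:
  fixes S :: "'a::field set"
  assumes "coprime d n" "n > 0" "\<And>x. x \<in> S \<Longrightarrow> x ^ n = 1"
  shows "inj_on (\<lambda>x. x ^ d) S"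
proof (rule inj_onI)
  fix x y assume xy: "x \<in> S" "y \<in> S" "x ^ d = y ^ d"
  obtain u where u: "[d * u = 1] (mod n)" using assms(1) cong_solve_coprime_nat by auto
  have "z ^ (d * u) = z" if "z \<in> S" for z
  \<comment> \<open>For \<open>n = 1\<close> the residue of \<open>d * u\<close> is 0 instead of 1,
    but then \<open>S\<close> contains nothing except 1.\<close>
  proof (cases "n = 1")
    case True
    then show ?thesis using assms(3)[OF that] by simp
  next
    case False
    then have "d * u mod n = 1" using u assms(2) by (auto simp: cong_def mod_less)
    then have "d * u = n * (d * u div n) + 1" using mult_div_mod_eq[of n "d * u"] by simp
    then have "z ^ (d * u) = (z ^ n) ^ (d * u div n) * z"
      by (metis power_add power_mult power_one_right)
    then show ?thesis using assms(3)[OF that] by simp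
  qed
  then show "x = y" using xy by (metis power_mult)
qed

section \<open>Finite fields of characteristic two\<close>

text \<open>The parameter \<open>ty\<close> lets an interpretation select the ambient field through
  \<open>TYPE('a)\<close>.\<close>

locale gf2_field =
  fixes N :: nat and ty :: "'a::finite_field itself"
  assumes card_UNIV: "card (UNIV :: 'a set) = 2 ^ N"
begin

declare One_nat_def [simp del]

lemma N_pos: "N > 0"
proof (rule ccontr)
  assume "\<not> N > 0"
  then have "is_singleton (UNIV :: 'a set)" using card_UNIV by (simp add: is_singleton_altdef)
  then show False by (metis UNIV_I is_singletonE singletonD zero_neq_one)
qed

lemma CHAR_2: "CHAR('a) = 2"
proof -
  have "CHAR('a) dvd 2 ^ N" using CHAR_dvd_CARD[where 'a = 'a] card_UNIV by simp
  then have "CHAR('a) dvd 2" using CHAR_prime prime_dvd_power by blast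
  then show ?thesis using CHAR_prime[where 'a='a] primes_dvd_imp_eq two_is_prime_nat by blast
qed

lemma minus_eq_add: "x - y = x + (y::'a)"
  using minus_CHAR_2[OF CHAR_2] .

lemma add_self [simp]: "x + x = (0::'a)"
  using minus_eq_add[of x x] by simp

lemma add_self_left [simp]: "x + (x + y) = (y::'a)"
  by (simp flip: add.assoc)

lemma add_eq_0 [simp]: "x + y = 0 \<longleftrightarrow> x = (y::'a)"
  using minus_eq_add[of x y] by (metis eq_iff_diff_eq_0)

lemma frobenius_add: "(x + y :: 'a) ^ (2 ^ k) = x ^ (2 ^ k) + y ^ (2 ^ k)"
  by (rule freshmans_dream'[where 'a='a, OF CHAR_prime]) (simp add: CHAR_2)

lemma frobenius_sum: "(sum f A :: 'a) ^ (2 ^ k) = (\<Sum>i\<in>A. f i ^ (2 ^ k))"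
  by (rule freshmans_dream_sum'[where 'a='a, OF CHAR_prime]) (simp add: CHAR_2)

lemma square_add: "(x + y :: 'a)\<^sup>2 = x\<^sup>2 + y\<^sup>2"
  using frobenius_add[of x y 1] by simp

lemma square_eq_iff: "x\<^sup>2 = y\<^sup>2 \<longleftrightarrow> x = (y::'a)"
  by (metis add_eq_0 power_zero_numeral square_add zero_eq_power2)

section \<open>Subfields as fixed points of powers of Frobenius\<close>

lemma GF2_0 [simp]: "(0::'a) \<in> GF2 k" by (simp add: GF2_def)
lemma GF2_1 [simp]: "(1::'a) \<in> GF2 k" by (simp add: GF2_def)
lemma GF2_add: "x \<in> GF2 k \<Longrightarrow> y \<in> GF2 k \<Longrightarrow> x + y \<in> (GF2 k :: 'a set)"
  by (simp add: GF2_def frobenius_add)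
lemma GF2_mult: "x \<in> GF2 k \<Longrightarrow> y \<in> GF2 k \<Longrightarrow> x * y \<in> (GF2 k :: 'a set)"
  by (simp add: GF2_def power_mult_distrib)
lemma GF2_inverse: "x \<in> GF2 k \<Longrightarrow> inverse x \<in> (GF2 k :: 'a set)"
  by (simp add: GF2_def power_inverse)
lemma GF2_power: "x \<in> GF2 k \<Longrightarrow> x ^ j \<in> (GF2 k :: 'a set)"
  by (induction j) (auto intro: GF2_mult)

lemma GF2_star_eq:
  assumes "k > 0"
  shows "GF2_star k = {x::'a. x ^ (2 ^ k - 1) = 1}"
proof -
  have "x ^ (2 ^ k) = x \<longleftrightarrow> x ^ (2 ^ k - 1) = 1" if "x \<noteq> 0" for x :: 'a
  proof -
    have "x ^ (2 ^ k) = x * x ^ (2 ^ k - 1)" by (subst power_Suc[symmetric]) simp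
    then show ?thesis using that by simp
  qed
  \<comment> \<open>Positivity of \<open>k\<close> enters here: with exponent 0 even 0 would satisfy
    the equation.\<close>
  moreover have "x \<noteq> 0" if "x ^ (2 ^ k - 1) = 1" for x :: 'a
    using that assms one_less_power[of "2::nat" k] by (auto simp: power_0_left One_nat_def split: if_splits)
  ultimately show ?thesis
    by (auto simp: GF2_star_def GF2_def)
qed

lemma card_GF2_star:
  assumes "k dvd N" "k > 0"
  shows "card (GF2_star k :: 'a set) = 2 ^ k - 1"
  using card_GF2[OF card_UNIV assms N_pos] by (simp add: GF2_star_def)

lemma GF2_star_iff: "x \<in> GF2_star k \<longleftrightarrow> x \<in> GF2 k \<and> (x::'a) \<noteq> 0"
  by (simp add: GF2_star_def)

lemma GF2_eq_insert: "GF2 k = insert 0 (GF2_star k :: 'a set)"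
  by (auto simp: GF2_star_def)

text \<open>An injective self-map of a finite set. It supplies square roots and the substitution of
  x^2 for x in sums.\<close>

lemma GF2_square_bij: "bij_betw (\<lambda>x. x\<^sup>2) (GF2 k) (GF2 k :: 'a set)"
proof -
  have inj: "inj_on (\<lambda>x. x\<^sup>2) (GF2 k :: 'a set)"
    by (simp add: inj_on_def square_eq_iff)
  have "(\<lambda>x. x\<^sup>2) ` GF2 k \<subseteq> (GF2 k :: 'a set)"
    by (auto intro: GF2_power)
  then have "(\<lambda>x. x\<^sup>2) ` GF2 k = (GF2 k :: 'a set)"
    using inj by (intro card_subset_eq) (auto simp: card_image)
  with inj show ?thesis by (simp add: bij_betw_def)
qed

lemma GF2_star_square_bij: "bij_betw (\<lambda>x. x\<^sup>2) (GF2_star k) (GF2_star k :: 'a set)"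
  using bij_betw_DiffI[OF GF2_square_bij, of "{0}" "{0}"] unfolding GF2_star_def
  by (auto simp: bij_betw_def)

lemma GF2_star_mult_bij:
  assumes "c \<in> GF2_star k"
  shows "bij_betw (\<lambda>x. c * x) (GF2_star k) (GF2_star k :: 'a set)"
  by (rule bij_betw_byWitness[where f' = "\<lambda>x. inverse c * x"])
    (use assms in \<open>auto simp: GF2_star_iff intro!: GF2_mult GF2_inverse\<close>)

section \<open>The absolute trace\<close>

lemma abs_trace_eq: "abs_trace l x = (\<Sum>j<l. (x::'a) ^ (2 ^ j))"
  by (simp add: rel_trace_def)

lemma abs_trace_add: "abs_trace l (x + y) = abs_trace l x + abs_trace l (y::'a)"
  by (simp add: abs_trace_eq frobenius_add sum.distrib)

lemma abs_trace_0 [simp]: "abs_trace l (0::'a) = 0"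
  by (simp add: abs_trace_eq power_0_left)

text \<open>The sum telescopes, as in Artin-Schreier theory. It is stated on the whole field because
  it is later applied to elements outside \<open>GF2 l\<close>.\<close>

lemma abs_trace_add_square: "abs_trace l (x + x\<^sup>2) = x + (x::'a) ^ (2 ^ l)"
proof (induction l)
  case (Suc l)
  have "x ^ (2 ^ l * 2) = (x\<^sup>2) ^ 2 ^ l" by (simp add: mult.commute flip: power_mult)
  with Suc show ?case
    by (simp add: abs_trace_eq frobenius_add ac_simps)
qed (simp add: abs_trace_eq)

lemma abs_trace_square:
  assumes "x \<in> GF2 l"
  shows "abs_trace l (x\<^sup>2) = abs_trace l (x::'a)"
  using abs_trace_add_square[of l x] assms by (simp add: abs_trace_add GF2_def)

text \<open>The trace equals its own square, since squaring the argument leaves it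
  unchanged.\<close>

lemma abs_trace_values:
  assumes "x \<in> GF2 l"
  shows "abs_trace l x \<in> {0, 1::'a}"
proof -
  have "(abs_trace l x)\<^sup>2 = abs_trace l (x\<^sup>2)"
    using frobenius_sum[of "\<lambda>j. x ^ 2 ^ j" "{..<l}" 1]
    by (simp add: abs_trace_eq mult.commute flip: power_mult)
  then have "abs_trace l x * abs_trace l x = abs_trace l x * 1"
    using abs_trace_square[OF assms] by (simp add: power2_eq_square)
  then show ?thesis by (subst (asm) mult_cancel_left) auto
qed

text \<open>Transitivity of the trace in a quadratic extension: the upper half of the conjugates is
  the lower half applied to the conjugate of x.\<close>

lemma abs_trace_double: "abs_trace (2 * l) (x::'a) = abs_trace l (x + x ^ (2 ^ l))"
proof -
  have "abs_trace (2 * l) x = (\<Sum>j<l. x ^ (2 ^ j)) + (\<Sum>j=l..<l+l. x ^ (2 ^ j))"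
    unfolding abs_trace_eq by (simp add: mult_2 lessThan_atLeast0 sum.atLeastLessThan_concat)
  also have "(\<Sum>j=l..<l+l. x ^ (2 ^ j)) = (\<Sum>j<l. x ^ (2 ^ (j + l)))"
    by (simp add: sum.shift_bounds_nat_ivl[of _ 0, simplified] lessThan_atLeast0)
  also have "\<dots> = abs_trace l (x ^ (2 ^ l))"
    by (simp add: abs_trace_eq power_add mult.commute flip: power_mult)
  finally show ?thesis by (simp only: abs_trace_add) (simp add: abs_trace_eq)
qed

section \<open>Additive characters and their orthogonality\<close>

text \<open>On \<open>GF2 l\<close> this is the canonical additive character; multiplicativity is
  claimed only there.\<close>

definition tr_chi :: "nat \<Rightarrow> 'a \<Rightarrow> real" where
  "tr_chi l x = chi (abs_trace l x)"

lemma tr_chi_0 [simp]: "tr_chi l 0 = 1"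
  by (simp add: tr_chi_def chi_def)

lemma tr_chi_add:
  assumes "x \<in> GF2 l" "y \<in> GF2 l"
  shows "tr_chi l (x + y) = tr_chi l x * tr_chi l y"
  using abs_trace_values[OF assms(1)] abs_trace_values[OF assms(2)]
  by (auto simp: tr_chi_def chi_def abs_trace_add)

lemma tr_chi_square: "x \<in> GF2 l \<Longrightarrow> tr_chi l (x\<^sup>2) = tr_chi l x"
  by (simp add: tr_chi_def abs_trace_square)

lemma tr_chi_values: "tr_chi l x = 1 \<or> tr_chi l x = -1"
  by (simp add: tr_chi_def chi_def)

text \<open>The trace is a polynomial of degree at most 2^(l-1), so it cannot vanish on all 2^l
  elements of \<open>GF2 l\<close>.\<close>

lemma exists_tr_chi_minus_one:
  assumes "l dvd N" "l > 0"
  shows "\<exists>x\<in>GF2 l. tr_chi l x = -1"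
proof (rule ccontr)
  assume "\<not> ?thesis"
  then have "GF2 l \<subseteq> {x::'a. abs_trace l x = 0}" by (fastforce simp: tr_chi_def chi_def)
  define p :: "'a poly" where "p = (\<Sum>j<l. monom 1 (2 ^ j))"
  have "poly p x = abs_trace l x" for x
    by (simp add: p_def abs_trace_eq poly_sum poly_monom)
  then have sub: "GF2 l \<subseteq> {x. poly p x = 0}" using \<open>GF2 l \<subseteq> _\<close> by simp
  \<comment> \<open>Only the summand \<open>j = 0\<close> contributes to the linear coefficient, so
    \<open>p\<close> is not the zero polynomial.\<close>
  have "coeff p 1 = (\<Sum>j<l. if j = 0 then 1 else 0)"
    unfolding p_def coeff_sum by (intro sum.cong) (auto simp: One_nat_def)
  also have "\<dots> = 1" using assms by simp
  finally have "p \<noteq> 0" by auto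
  have "degree p \<le> 2 ^ (l - 1)"
    unfolding p_def
  proof (intro degree_sum_le)
    fix j assume "j \<in> {..<l}"
    then have "(2::nat) ^ j \<le> 2 ^ (l - 1)" by (intro power_increasing) auto
    then show "degree (monom (1::'a) (2 ^ j)) \<le> 2 ^ (l - 1)" by (simp add: degree_monom_eq)
  qed simp
  moreover have "(2::nat) ^ (l - 1) < 2 ^ l" using assms by (intro power_strict_increasing) auto
  moreover have "card (GF2 l :: 'a set) \<le> card {x. poly p x = 0}"
    using sub by (intro card_mono) auto
  ultimately show False
    using card_poly_roots_bound[OF \<open>p \<noteq> 0\<close>] card_GF2[OF card_UNIV assms N_pos] by linarith
qed

text \<open>Translation by an element of character value -1 permutes the field and negates the
  sum.\<close>

lemma sum_tr_chi:
  assumes "l dvd N" "l > 0"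
  shows "(\<Sum>x\<in>GF2 l. tr_chi l x) = 0"
proof -
  obtain z where z: "z \<in> GF2 l" "tr_chi l z = -1" using exists_tr_chi_minus_one assms by blast
  have "bij_betw (\<lambda>x. z + x) (GF2 l) (GF2 l)"
    by (rule bij_betw_byWitness[where f' = "\<lambda>x. z + x"]) (use z in \<open>auto intro: GF2_add\<close>)
  then have "(\<Sum>x\<in>GF2 l. tr_chi l x) = (\<Sum>x\<in>GF2 l. tr_chi l (z + x))"
    by (rule sum.reindex_bij_betw[symmetric])
  also have "\<dots> = - (\<Sum>x\<in>GF2 l. tr_chi l x)"
    using z by (simp add: tr_chi_add sum_negf)
  finally show ?thesis by simp
qed

lemma sum_tr_chi_mult_star:
  assumes "l dvd N" "l > 0" "c \<in> GF2 l"
  shows "(\<Sum>x\<in>GF2_star l. tr_chi l (c * x)) = (if c = 0 then 2 ^ l - 1 else - 1)"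
proof (cases "c = 0")
  case True
  then show ?thesis using assms by (simp add: card_GF2_star of_nat_diff)
next
  case False
  with assms have "bij_betw (\<lambda>x. c * x) (GF2_star l) (GF2_star l)"
    by (intro GF2_star_mult_bij) (simp add: GF2_star_iff)
  then have "(\<Sum>x\<in>GF2_star l. tr_chi l (c * x)) = (\<Sum>x\<in>GF2_star l. tr_chi l x)"
    by (rule sum.reindex_bij_betw)
  also have "\<dots> = - 1"
    using sum_tr_chi[OF assms(1,2)] unfolding GF2_eq_insert by (simp add: GF2_star_iff)
  finally show ?thesis using False by simp
qed

section \<open>Groups of roots of unity\<close>

lemma two_power_double_minus_1: "(2::nat) ^ (2 * l) - 1 = (2 ^ l + 1) * (2 ^ l - 1)"
  by (simp only: mult_2 power_add) (simp add: algebra_simps)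

text \<open>Since 2^l + 1 divides 2^(2l) - 1, every such root of unity in the ambient field already
  lies in \<open>GF2 (2 * l)\<close>.\<close>

lemma roots_of_unity_in_eq:
  assumes "l > 0" "2 * l dvd N"
  shows "roots_of_unity_in (2 * l) (2 ^ l + 1) = {x::'a. x ^ (2 ^ l + 1) = 1}"
proof -
  have "x ^ (2 ^ (2 * l) - 1) = 1" if "x ^ (2 ^ l + 1) = 1" for x :: 'a
    using that by (metis two_power_double_minus_1 power_mult power_one)
  then show ?thesis
    using assms by (auto simp: roots_of_unity_in_def GF2_star_eq)
qed

lemma card_power_fibre:
  assumes "k dvd N" "k > 0" "2 ^ k - 1 = d * e" "y ^ e = 1"
  shows "card {x::'a. x ^ d = y} = d"
proof (rule card_power_eq[where e = e])
  have "(2::nat) ^ k > 1" using assms by (intro one_less_power) auto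
  then have "d * e \<noteq> 0" using assms(3) by linarith
  then show "d > 0" "e > 0" by auto
  show "card {x::'a. x ^ (d * e) = 1} = d * e"
    using assms card_GF2_star[of k] GF2_star_eq[of k] by simp
qed fact

subsection \<open>Split and nonsplit torus\<close>

abbreviation U :: "nat \<Rightarrow> 'a set" where
  "U l \<equiv> roots_of_unity_in (2 * l) (2 ^ l + 1)"

text \<open>The difference of the two values factors as (z + x)(z + x^-1)/z.\<close>

lemma add_inverse_fibre:
  assumes "x \<noteq> 0" "z \<noteq> (0::'a)"
  shows "z + inverse z = x + inverse x \<longleftrightarrow> z = x \<or> z = inverse x"
proof -
  have "z + inverse z + (x + inverse x) = (z + x) * (z + inverse x) * inverse z"
    using assms by (simp add: field_simps)
  then have "z + inverse z = x + inverse x \<longleftrightarrow> (z + x) * (z + inverse x) * inverse z = 0"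
    by (metis add_eq_0)
  then show ?thesis using assms by simp
qed

text \<open>In characteristic two 1 is the only square root of 1; the case of 0 comes from
  \<open>inverse 0 = 0\<close>.\<close>

lemma inverse_eq_self: "inverse x = x \<longleftrightarrow> x = 0 \<or> x = (1::'a)"
proof
  assume h: "inverse x = x"
  show "x = 0 \<or> x = 1"
  proof (cases "x = 0")
    case False
    then have "x\<^sup>2 = 1\<^sup>2" using h by (metis left_inverse one_power2 power2_eq_square)
    then show ?thesis using square_eq_iff by blast
  qed simp
qed auto

text \<open>The fibres are the pairs {x, x^-1}, which have two elements because 0 and 1 are
  excluded.\<close>

lemma sum_add_inverse_image:
  fixes g :: "'a \<Rightarrow> real"
  assumes A: "0 \<notin> A" "1 \<notin> A" "\<And>x. x \<in> A \<Longrightarrow> inverse x \<in> A"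
  shows "(\<Sum>x\<in>A. g (x + inverse x)) = 2 * (\<Sum>t\<in>(\<lambda>x. x + inverse x) ` A. g t)"
proof -
  have "card {z \<in> A. z + inverse z = t} = 2" if t: "t \<in> (\<lambda>x. x + inverse x) ` A" for t
  proof -
    obtain x where x: "x \<in> A" "t = x + inverse x" using t by blast
    have "{z \<in> A. z + inverse z = t} = {x, inverse x}"
      using A x add_inverse_fibre by (auto; metis)
    moreover have "x \<noteq> inverse x" using A x inverse_eq_self by metis
    ultimately show ?thesis by simp
  qed
  then show ?thesis
    by (subst sum_comp_const_fibres[where k = 2 and B = "(\<lambda>x. x + inverse x) ` A"]) auto
qed

text \<open>Since x + x^-1 = (x+1)^2/x, its inverse has the Artin-Schreier form w + w^2 with w =
  (x+1)^-1.\<close>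

lemma inverse_add_inverse:
  assumes "x \<noteq> 0" "x \<noteq> (1::'a)"
  shows "inverse (x + inverse x) = inverse (x + 1) + (inverse (x + 1))\<^sup>2"
proof -
  have nz: "x + 1 \<noteq> 0" using assms by simp
  have "x + inverse x = (x + 1)\<^sup>2 * inverse x"
    using assms unfolding square_add by (simp add: field_simps power2_eq_square)
  then have "inverse (x + inverse x) = x * (inverse (x + 1))\<^sup>2"
    using assms by (simp add: power_inverse)
  also have "\<dots> = ((x + 1) + 1) * (inverse (x + 1))\<^sup>2" by (simp add: add.assoc)
  also have "\<dots> = (x + 1) * inverse (x + 1) * inverse (x + 1) + (inverse (x + 1))\<^sup>2"
    by (simp only: distrib_right[of "x + 1" 1] power2_eq_square mult_1_left mult.assoc)
  also have "\<dots> = inverse (x + 1) + (inverse (x + 1))\<^sup>2"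
    by (simp only: right_inverse[OF nz] mult_1_left)
  finally show ?thesis by simp
qed

text \<open>With w = (x+1)^-1 the trace telescopes to w + w^(2^l). This is 0 for x in
  \<open>GF2 l\<close> and 1 for x in \<open>U l\<close>, which separates the two tori.\<close>

lemma tr_chi_inverse_add_inverse:
  assumes x: "x \<noteq> 0" "x \<noteq> 1"
  shows "tr_chi l (inverse (x + inverse x)) = chi (inverse (x + 1) + inverse (x ^ (2 ^ l) + 1))"
  unfolding tr_chi_def inverse_add_inverse[OF x] abs_trace_add_square
  by (simp add: power_inverse frobenius_add)

text \<open>The weight on the right is 2 where the character equals \<open>s\<close> and 0
  elsewhere.\<close>

lemma sum_tr_chi_filter:
  fixes g :: "'a \<Rightarrow> real"
  assumes "s = 1 \<or> s = - 1"
  shows "2 * (\<Sum>t | t \<in> GF2_star l \<and> tr_chi l (inverse t) = s. g t)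
    = (\<Sum>t\<in>GF2_star l. (1 + s * tr_chi l (inverse t)) * g t)"
proof -
  have "2 * (\<Sum>t | t \<in> GF2_star l \<and> tr_chi l (inverse t) = s. g t)
    = (\<Sum>t\<in>GF2_star l. if tr_chi l (inverse t) = s then 2 * g t else 0)"
    by (simp add: sum_distrib_left sum.inter_filter if_distrib cong: if_cong)
  also have "\<dots> = (\<Sum>t\<in>GF2_star l. (1 + s * tr_chi l (inverse t)) * g t)"
  proof (rule sum.cong)
    fix t
    show "(if tr_chi l (inverse t) = s then 2 * g t else 0) = (1 + s * tr_chi l (inverse t)) * g t"
      using assms tr_chi_values[of l "inverse t"] by auto
  qed simp
  finally show ?thesis .
qed

context
  fixes l :: nat
  assumes l: "l > 0" "2 * l dvd N"
begin

lemma l_dvd: "l dvd N" using l by (metis dvd_mult_right)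

lemma card_U: "card (U l) = 2 ^ l + 1"
  unfolding roots_of_unity_in_eq[OF l]
  using l card_power_fibre[of "2 * l" "2 ^ l + 1" "2 ^ l - 1" 1] two_power_double_minus_1 by simp

lemma U_frobenius: "x \<in> U l \<Longrightarrow> x ^ (2 ^ l) = inverse x"
  unfolding roots_of_unity_in_eq[OF l] by (simp add: inverse_unique power_add mult.commute)

lemma U_nonzero: "x \<in> U l \<Longrightarrow> x \<noteq> 0"
  unfolding roots_of_unity_in_eq[OF l] by (auto simp: power_0_left)

lemma U_mult: "x \<in> U l \<Longrightarrow> y \<in> U l \<Longrightarrow> x * y \<in> U l"
  unfolding roots_of_unity_in_eq[OF l] by (simp add: power_mult_distrib)

lemma U_inverse: "x \<in> U l \<Longrightarrow> inverse x \<in> U l"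
  unfolding roots_of_unity_in_eq[OF l] by (simp add: power_inverse)

lemma U_1 [simp]: "1 \<in> U l"
  unfolding roots_of_unity_in_eq[OF l] by simp

text \<open>The telescoped trace gives the inclusions. Equality follows by counting: the images have
  2^(l-1) - 1 and 2^(l-1) elements, together as many as \<open>GF2_star l\<close>.\<close>

lemma add_inverse_split:
  defines "f \<equiv> \<lambda>x. x + inverse x"
  shows "f ` (GF2_star l - {1}) = {t \<in> GF2_star l. tr_chi l (inverse t) = 1}"
    and "f ` (U l - {1}) = {t \<in> GF2_star l. tr_chi l (inverse t) = - 1}"
proof -
  let ?A0 = "GF2_star l - {1::'a}" and ?A1 = "U l - {1}"
    and ?T0 = "{t \<in> GF2_star l. tr_chi l (inverse t) = 1}"
    and ?T1 = "{t \<in> GF2_star l. tr_chi l (inverse t) = - 1}"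
  have sub0: "f ` ?A0 \<subseteq> ?T0"
  proof
    fix t assume "t \<in> f ` ?A0"
    then obtain x where x: "x \<in> GF2 l" "x \<noteq> 0" "x \<noteq> 1" and t: "t = x + inverse x"
      unfolding f_def GF2_star_def by blast
    have "tr_chi l (inverse t) = 1"
      unfolding t using x by (subst tr_chi_inverse_add_inverse) (auto simp: GF2_def chi_def)
    moreover have "t \<in> GF2_star l"
      using x inverse_eq_self[of x] unfolding t by (auto simp: GF2_star_iff intro!: GF2_add GF2_inverse)
    ultimately show "t \<in> ?T0" by simp
  qed
  have sub1: "f ` ?A1 \<subseteq> ?T1"
  proof
    fix t assume "t \<in> f ` ?A1"
    then obtain x where x: "x \<in> U l" "x \<noteq> 0" "x \<noteq> 1" and t: "t = x + inverse x"
      unfolding f_def using U_nonzero by blast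
    have nz: "x + 1 \<noteq> 0" using x by simp
    \<comment> \<open>Conjugation sends w = (x+1)^-1 to (x^-1+1)^-1 = 1 + w, so the telescoped trace
      is 1.\<close>
    have "inverse x + 1 = (x + 1) * inverse x" using x by (simp add: field_simps)
    then have "inverse (x + 1) + inverse (inverse x + 1) = inverse (x + 1) * (x + 1)"
      using x by (simp add: field_simps)
    also have "\<dots> = 1" using nz by simp
    finally have "tr_chi l (inverse t) = - 1"
      unfolding t using x by (subst tr_chi_inverse_add_inverse) (auto simp: U_frobenius chi_def)
    moreover have "t \<noteq> 0" using x inverse_eq_self[of x] unfolding t by auto
    moreover have "t ^ (2 ^ l) = t"
      using x by (simp add: t frobenius_add power_inverse U_frobenius add.commute)
    ultimately show "t \<in> ?T1" by (simp add: GF2_star_iff GF2_def)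
  qed
  have A0: "real (card ?A0) = 2 * real (card (f ` ?A0))"
  proof -
    have "(\<Sum>x\<in>?A0. 1) = 2 * (\<Sum>t\<in>f ` ?A0. 1::real)"
      unfolding f_def
      by (rule sum_add_inverse_image) (auto simp: GF2_star_iff intro: GF2_inverse)
    then show ?thesis by simp
  qed
  have A1: "real (card ?A1) = 2 * real (card (f ` ?A1))"
  proof -
    have "(\<Sum>x\<in>?A1. 1) = 2 * (\<Sum>t\<in>f ` ?A1. 1::real)"
      unfolding f_def
      by (rule sum_add_inverse_image) (use U_nonzero in \<open>auto intro: U_inverse\<close>)
    then show ?thesis by simp
  qed
  have un: "GF2_star l = ?T0 \<union> ?T1" "?T0 \<inter> ?T1 = {}" using tr_chi_values by auto
  have ge: "(2::nat) ^ l \<ge> 2" using l power_increasing[of 1 l "2::nat"] by simp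
  have "card (GF2_star l :: 'a set) = card ?T0 + card ?T1"
    by (subst un(1), rule card_Un_disjoint) (use un(2) in auto)
  then have T: "card ?T0 + card ?T1 + 1 = 2 ^ l"
    using card_GF2_star[OF l_dvd l(1)] ge by simp
  have "card ?A0 + 2 = 2 ^ l" "card ?A1 = 2 ^ l"
    using card_GF2_star[OF l_dvd l(1)] card_U ge by (simp_all add: GF2_star_iff)
  then have c: "2 * card (f ` ?A0) + 2 = 2 ^ l" "2 * card (f ` ?A1) = 2 ^ l"
    using A0 A1 by linarith+
  have le: "card (f ` ?A0) \<le> card ?T0" "card (f ` ?A1) \<le> card ?T1"
    using sub0 sub1 by (auto intro: card_mono)
  show "f ` ?A0 = ?T0" using sub0 c T le by (intro card_subset_eq) auto
  show "f ` ?A1 = ?T1" using sub1 c T le by (intro card_subset_eq) auto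
qed

lemma sum_GF2_star_add_inverse:
  fixes g :: "'a \<Rightarrow> real"
  shows "(\<Sum>x\<in>GF2_star l - {1}. g (x + inverse x))
    = (\<Sum>t\<in>GF2_star l. (1 + tr_chi l (inverse t)) * g t)"
proof -
  have "(\<Sum>x\<in>GF2_star l - {1}. g (x + inverse x))
      = 2 * (\<Sum>t | t \<in> GF2_star l \<and> tr_chi l (inverse t) = 1. g t)"
    unfolding add_inverse_split(1)[symmetric]
    by (rule sum_add_inverse_image) (auto simp: GF2_star_iff intro: GF2_inverse)
  then show ?thesis using sum_tr_chi_filter[of 1 g] by simp
qed

lemma sum_U_add_inverse:
  fixes g :: "'a \<Rightarrow> real"
  shows "(\<Sum>x\<in>U l - {1}. g (x + inverse x))
    = (\<Sum>t\<in>GF2_star l. (1 - tr_chi l (inverse t)) * g t)"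
proof -
  have "(\<Sum>x\<in>U l - {1}. g (x + inverse x))
      = 2 * (\<Sum>t | t \<in> GF2_star l \<and> tr_chi l (inverse t) = - 1. g t)"
    unfolding add_inverse_split(2)[symmetric]
    by (rule sum_add_inverse_image) (use U_nonzero in \<open>auto intro: U_inverse\<close>)
  then show ?thesis using sum_tr_chi_filter[of "-1" g] by simp
qed

section \<open>Polar decomposition\<close>

text \<open>Raising v r = v' r' to the power 2^l inverts v and v' and fixes r and r'; multiplying by
  the original equation leaves r^2 = r'^2. Surjectivity is a count.\<close>

lemma polar_bij: "bij_betw (\<lambda>(v, r). v * r) (U l \<times> GF2_star l) (GF2_star (2 * l) :: 'a set)"
proof -
  have inj: "inj_on (\<lambda>(v, r). v * r) (U l \<times> (GF2_star l :: 'a set))"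
  proof (rule inj_onI, clarify)
    fix v r v' r'
    assume h: "v \<in> U l" "v' \<in> U l" "r \<in> GF2_star l" "r' \<in> GF2_star l" "v * r = v' * r'"
    have e: "z * x * (inverse z * x) = x\<^sup>2" if "z \<noteq> 0" for z x :: 'a
      using that by (simp add: field_simps power2_eq_square)
    have nz: "v \<noteq> 0" "v' \<noteq> 0" "r \<noteq> 0" "r' \<noteq> 0" using h U_nonzero by (auto simp: GF2_star_iff)
    have "inverse v * r = inverse v' * r'"
      using h(1-4) arg_cong[OF h(5), of "\<lambda>x. x ^ (2 ^ l)"]
      by (simp add: power_mult_distrib U_frobenius GF2_star_iff GF2_def)
    then have "(v * r) * (inverse v * r) = (v' * r') * (inverse v' * r')"
      using h(5) by simp
    then have "r\<^sup>2 = r'\<^sup>2"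
      using nz by (simp add: e)
    then have "r = r'" using square_eq_iff by blast
    with h(5) nz show "v = v' \<and> r = r'" by simp
  qed
  moreover have "(\<lambda>(v, r). v * r) ` (U l \<times> GF2_star l) = (GF2_star (2 * l) :: 'a set)"
  proof (rule card_subset_eq)
    show "(\<lambda>(v, r). v * r) ` (U l \<times> GF2_star l) \<subseteq> (GF2_star (2 * l) :: 'a set)"
    proof clarify
      fix v r :: 'a assume h: "v \<in> U l" "r \<in> GF2_star l"
      then have "r ^ (2 ^ l * 2 ^ l) = r" by (simp add: power_mult GF2_star_iff GF2_def)
      then have "r \<in> GF2 (2 * l)" by (simp add: GF2_def mult_2 power_add)
      with h show "v * r \<in> GF2_star (2 * l)"
        by (auto simp: roots_of_unity_in_def GF2_star_iff intro: GF2_mult)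
    qed
    show "card ((\<lambda>(v, r). v * r) ` (U l \<times> (GF2_star l :: 'a set))) = card (GF2_star (2 * l) :: 'a set)"
      using l l_dvd card_U
      by (simp add: card_image[OF inj] card_cartesian_product card_GF2_star two_power_double_minus_1)
  qed simp
  ultimately show ?thesis by (simp add: bij_betw_def)
qed

end

end

section \<open>Cubic classes\<close>

lemma psi_mult: "psi m (x * y) = psi m x * psi m y"
  by (simp add: psi_def power_mult_distrib)

lemma psi_inverse: "psi m (inverse x) = inverse (psi m x)"
  by (simp add: psi_def power_inverse)

lemma psi_power: "psi m (x ^ k) = psi m x ^ k"
  by (simp add: psi_def mult.commute flip: power_mult)

lemma psi_1 [simp]: "psi m 1 = 1"
  by (simp add: psi_def)

lemma cube_root_of_unity_inverse:
  fixes p :: "'a::field"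
  assumes "p ^ 3 = 1"
  shows "p\<^sup>2 = inverse p"
  using assms by (metis inverse_unique power2_eq_square power3_eq_cube mult.assoc)

lemma cube_root_of_unity_power:
  fixes p :: "'a::field"
  assumes "p ^ 3 = 1"
  shows "p ^ n = p ^ (n mod 3)"
  by (metis assms div_mult_mod_eq mult.commute mult_1 power_add power_mult power_one)

text \<open>The ambient degree \<open>2 * m1\<close> is the m0 of the theorem, so
  \<open>GF2 m2\<close>, \<open>GF2 m1\<close> and the whole field form two quadratic steps.\<close>

locale gf2_tower = gf2_field "2 * m1" ty for m1 :: nat and ty :: "'a::finite_field itself" +
  fixes m2 :: nat
  assumes m1_eq: "m1 = 2 * m2" and odd_m2: "odd m2"
begin

declare One_nat_def [simp del]

abbreviation "F1 \<equiv> GF2_star m1 :: 'a set"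

lemma m2: "m2 > 0" "2 * m2 dvd 2 * m1" and m1: "m1 > 0" "2 * m1 dvd 2 * m1"
  using odd_m2 m1_eq by (auto intro: odd_pos)

lemma polar_F1: "bij_betw (\<lambda>(v, r). v * r) (U m2 \<times> GF2_star m2) F1"
  using polar_bij[OF m2] m1_eq by simp

text \<open>A third of the order of \<open>U m2\<close>, exact because \<open>m2\<close> is odd. It
  is the size of each fibre of \<open>psi m1\<close> on \<open>U m2\<close>.\<close>

definition d :: nat where "d = (2 ^ m2 + 1) div 3"

lemma d: "2 ^ m2 + 1 = 3 * d" and d_pos: "d > 0"
proof -
  obtain k where k: "m2 = 2 * k + 1" using odd_m2 oddE by blast
  have "(4::nat) ^ k mod 3 = 1" by (subst power_mod[symmetric]) simp
  moreover have "(2::nat) ^ m2 = 2 * 4 ^ k" unfolding k power_add power_mult by simp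
  ultimately have "(2::nat) ^ m2 mod 3 = 2" by presburger
  then have "(2 ^ m2 + 1) mod 3 = (0::nat)" by presburger
  then show "2 ^ m2 + 1 = 3 * d" unfolding d_def by presburger
  then show "d > 0" by (cases "d = 0") auto
qed

lemma two_power_m1: "(2::nat) ^ m1 - 1 = 3 * (d * (2 ^ m2 - 1))"
  using two_power_double_minus_1[of m2] d m1_eq by simp

lemma psi_exponent: "(2 ^ m1 - 1) div 3 = d * (2 ^ m2 - 1)"
  unfolding two_power_m1 by simp

lemma psi_cube:
  assumes "x \<in> F1"
  shows "psi m1 x ^ 3 = 1"
proof -
  have "psi m1 x ^ 3 = x ^ (2 ^ m1 - 1)"
    unfolding psi_def psi_exponent two_power_m1 by (simp add: ac_simps flip: power_mult)
  then show ?thesis using assms m1 GF2_star_eq[of m1] by simp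
qed

text \<open>The exponent of \<open>psi m1\<close> is a multiple of the group order 2^m2 - 1. This
  triviality on the subfield is the semiprimitive situation.\<close>

lemma psi_GF2_star_m2:
  assumes "r \<in> GF2_star m2"
  shows "psi m1 r = (1::'a)"
proof -
  have "r ^ (2 ^ m2 - 1) = 1" using assms m2 GF2_star_eq[of m2] by simp
  then show ?thesis
    unfolding psi_def psi_exponent by (simp add: mult.commute[of d] power_mult)
qed

lemma U_m2_eq: "U m2 = {v. (v ^ d) ^ 3 = 1}"
proof -
  have "v ^ (2 ^ m2 + 1) = (v ^ d) ^ 3" for v :: 'a
    by (simp only: d mult.commute[of 3] power_mult)
  then show ?thesis unfolding roots_of_unity_in_eq[OF m2] by simp
qed

text \<open>As \<open>v ^ d\<close> is a cube root of unity and 2^m2 - 1 is 1 modulo 3, the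
  remaining factor of the exponent has no effect.\<close>

lemma psi_U:
  assumes "v \<in> U m2"
  shows "psi m1 v = v ^ d"
proof -
  have "(v ^ d) ^ 3 = 1"
    using assms U_m2_eq by simp
  moreover have "(2 ^ m2 - 1) mod 3 = (1::nat)"
  proof -
    have "(2::nat) ^ m2 - 1 = 3 * (d - 1) + 1" using d d_pos by linarith
    then show ?thesis by simp
  qed
  ultimately show ?thesis
    unfolding psi_def psi_exponent using cube_root_of_unity_power[of "v ^ d" "2 ^ m2 - 1"]
    by (simp add: power_mult)
qed

lemma card_U_psi:
  assumes "\<beta> ^ 3 = 1"
  shows "card {v \<in> U m2. psi m1 v = \<beta>} = d"
proof -
  have "{v \<in> U m2. psi m1 v = \<beta>} = {v. v ^ d = \<beta>}"
    using assms psi_U U_m2_eq by auto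
  moreover have "\<beta> ^ (3 * (2 ^ m2 - 1)) = 1" using assms by (simp only: power_mult power_one)
  ultimately show ?thesis
    using card_power_fibre[of m1 d "3 * (2 ^ m2 - 1)" \<beta>] m1 m2 two_power_m1 by (simp add: ac_simps)
qed

text \<open>
  In polar coordinates $s = vr$ with $v \in U_2$, $r \in \mathbb{F}_{2^{m_2}}^*$, the value $\psi(s)$
  depends on $v$ only, and the sum over $r$ detects $v = 1$.
\<close>

lemma cubic_gauss_period:
  assumes \<beta>: "\<beta> ^ 3 = 1"
  shows "(\<Sum>s | s \<in> F1 \<and> psi m1 s = \<beta>. tr_chi m1 s) = (if \<beta> = 1 then 2 ^ m2 else 0) - (2 ^ m2 + 1) / 3"
proof -
  let ?g = "\<lambda>s. if psi m1 s = \<beta> then tr_chi m1 s else 0"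
  let ?V = "{v \<in> U m2. psi m1 v = \<beta>}"
  have "(\<Sum>s | s \<in> F1 \<and> psi m1 s = \<beta>. tr_chi m1 s) = (\<Sum>s\<in>F1. ?g s)"
    by (simp add: sum.inter_filter)
  also have "\<dots> = (\<Sum>(v, r)\<in>U m2 \<times> GF2_star m2. ?g (v * r))"
    by (subst sum.reindex_bij_betw[OF polar_F1, symmetric]) (auto intro!: sum.cong)
  also have "\<dots> = (\<Sum>v\<in>U m2. if psi m1 v = \<beta> then (\<Sum>r\<in>GF2_star m2. tr_chi m1 (v * r)) else 0)"
    by (subst sum.cartesian_product[symmetric])
      (auto intro!: sum.cong simp: psi_mult psi_GF2_star_m2)
  also have "\<dots> = (\<Sum>v\<in>?V. \<Sum>r\<in>GF2_star m2. tr_chi m1 (v * r))"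
    by (simp add: sum.inter_filter)
  also have "\<dots> = (\<Sum>v\<in>?V. (if v = 1 then 2 ^ m2 else 0) - 1)"
  proof (rule sum.cong)
    fix v assume v: "v \<in> ?V"
    \<comment> \<open>Conjugation over \<open>GF2 m2\<close> inverts v and fixes r, so the trace of
      v r to \<open>GF2 m2\<close> is (v + v^-1) r.\<close>
    have "tr_chi m1 (v * r) = tr_chi m2 ((v + inverse v) * r)" if "r \<in> GF2_star m2" for r
      using that v unfolding tr_chi_def abs_trace_double[of m2, folded m1_eq]
      by (simp add: power_mult_distrib U_frobenius[OF m2] GF2_star_iff GF2_def distrib_right)
    moreover have "v + inverse v \<in> GF2 m2"
      using v by (simp add: GF2_def frobenius_add power_inverse U_frobenius[OF m2] add.commute)
    moreover have "v + inverse v = 0 \<longleftrightarrow> v = 1"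
      using v inverse_eq_self[of v] U_nonzero[OF m2, of v] by auto
    ultimately show "(\<Sum>r\<in>GF2_star m2. tr_chi m1 (v * r)) = (if v = 1 then 2 ^ m2 else 0) - 1"
      using m2 by (simp add: sum_tr_chi_mult_star)
  qed simp
  also have "\<dots> = (\<Sum>v\<in>?V. if v = 1 then 2 ^ m2 else 0) - real d"
    by (simp add: sum_subtractf card_U_psi[OF \<beta>])
  also have "(\<Sum>v\<in>?V. if v = 1 then 2 ^ m2 else 0) = (if \<beta> = 1 then 2 ^ m2 else (0::real))"
    using U_1[OF m2] by (simp add: sum.delta)
  also have "real d = (2 ^ m2 + 1) / 3"
    using arg_cong[OF d, of real] by simp
  finally show ?thesis .
qed

text \<open>As 3 divides 2^m1 - 1, cubing is three-to-one from \<open>F1\<close> onto the kernel of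
  \<open>psi m1\<close>.\<close>

lemma sum_cubes:
  fixes g :: "'a \<Rightarrow> real"
  shows "(\<Sum>x\<in>F1. g (x ^ 3)) = 3 * (\<Sum>s | s \<in> F1 \<and> psi m1 s = 1. g s)"
proof -
  let ?e = "d * (2 ^ m2 - 1)"
  have F1: "F1 = {x. x ^ (3 * ?e) = 1}" using GF2_star_eq[of m1] m1 two_power_m1 by simp
  have "(\<Sum>x\<in>F1. g (x ^ 3)) = real 3 * (\<Sum>s | s \<in> F1 \<and> psi m1 s = 1. g s)"
  proof (rule sum_comp_const_fibres)
    show "(\<lambda>x. x ^ 3) ` F1 \<subseteq> {s. s \<in> F1 \<and> psi m1 s = 1}"
      using psi_cube by (auto simp: psi_power GF2_star_iff intro: GF2_power)
    fix s assume s: "s \<in> {s. s \<in> F1 \<and> psi m1 s = 1}"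
    then have s: "s ^ ?e = 1" by (simp add: psi_def psi_exponent)
    then have "{x \<in> F1. x ^ 3 = s} = {x. x ^ 3 = s}"
      unfolding F1 by (auto simp: power_mult)
    then show "card {x \<in> F1. x ^ 3 = s} = 3"
      using card_power_fibre[of m1 3 ?e s] s m1 two_power_m1 by simp
  qed auto
  then show ?thesis by simp
qed

text \<open>The mixed terms of the cube are 3(x + x^-1), which is x + x^-1 in characteristic
  two.\<close>

lemma cube_add_inverse:
  assumes "x \<noteq> (0::'a)"
  shows "x ^ 3 + inverse x ^ 3 = (x + inverse x) ^ 3 + (x + inverse x)"
proof -
  have "(x + y) ^ 3 + x * y * (x + y) = x ^ 3 + y ^ 3" for y :: 'a
    by (simp add: power3_eq_cube algebra_simps)
  from this[of "inverse x"] show ?thesis using assms by simp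
qed

section \<open>Kloosterman and cubic sums\<close>

lemma kloosterman_sum_eq: "kloosterman_sum m1 c = 1 + (\<Sum>x\<in>F1. tr_chi m1 (c * x + inverse x))"
  unfolding kloosterman_sum_def tr_chi_def[symmetric] GF2_eq_insert by (simp add: GF2_star_iff)

lemma cubic_sum_eq: "cubic_sum m1 c c = 1 + (\<Sum>x\<in>F1. tr_chi m1 (c * (x ^ 3 + x)))"
  unfolding cubic_sum_def tr_chi_def[symmetric] GF2_eq_insert by (simp add: GF2_star_iff distrib_left)

text \<open>Substituting x^2 for x makes the argument a square, and the trace is Frobenius
  invariant. Results for the square root c of a thereby carry over to a.\<close>

lemma kloosterman_sum_square:
  assumes "c \<in> F1"
  shows "kloosterman_sum m1 (c\<^sup>2) = kloosterman_sum m1 c"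
proof -
  have "(\<Sum>x\<in>F1. tr_chi m1 (c\<^sup>2 * x + inverse x)) = (\<Sum>x\<in>F1. tr_chi m1 (c\<^sup>2 * x\<^sup>2 + inverse (x\<^sup>2)))"
    by (rule sum.reindex_bij_betw[OF GF2_star_square_bij, symmetric])
  also have "\<dots> = (\<Sum>x\<in>F1. tr_chi m1 ((c * x + inverse x)\<^sup>2))"
    by (simp add: square_add power_mult_distrib power_inverse)
  also have "\<dots> = (\<Sum>x\<in>F1. tr_chi m1 (c * x + inverse x))"
    using assms by (auto intro!: sum.cong tr_chi_square GF2_add GF2_mult GF2_inverse simp: GF2_star_iff)
  finally show ?thesis by (simp add: kloosterman_sum_eq)
qed

lemma cubic_sum_square:
  assumes "c \<in> F1"
  shows "cubic_sum m1 (c\<^sup>2) (c\<^sup>2) = cubic_sum m1 c c"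
proof -
  have "(\<Sum>x\<in>F1. tr_chi m1 (c\<^sup>2 * (x ^ 3 + x))) = (\<Sum>x\<in>F1. tr_chi m1 (c\<^sup>2 * ((x\<^sup>2) ^ 3 + x\<^sup>2)))"
    by (rule sum.reindex_bij_betw[OF GF2_star_square_bij, symmetric])
  also have "\<dots> = (\<Sum>x\<in>F1. tr_chi m1 ((c * (x ^ 3 + x))\<^sup>2))"
    by (simp add: square_add power_mult_distrib mult.commute flip: power_mult)
  also have "\<dots> = (\<Sum>x\<in>F1. tr_chi m1 (c * (x ^ 3 + x)))"
    using assms by (auto intro!: sum.cong tr_chi_square GF2_add GF2_mult GF2_power simp: GF2_star_iff)
  finally show ?thesis by (simp add: cubic_sum_eq)
qed

text \<open>Since 2^m1 is 1 modulo 3, the group order 2^m1 + 1 is coprime to 3. The fixed point 1 is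
  left out because it corresponds to t = 0.\<close>

lemma U_cube_bij: "bij_betw (\<lambda>x. x ^ 3) (U m1 - {1}) (U m1 - {1})"
proof -
  have "(2::nat) ^ m1 + 1 = 3 * (d * (2 ^ m2 - 1)) + 2"
    using two_power_m1 one_le_power[of "2::nat" m1] by linarith
  then have "\<not> 3 dvd (2::nat) ^ m1 + 1" by presburger
  then have cop: "coprime 3 ((2::nat) ^ m1 + 1)" by (intro prime_imp_coprime) auto
  have inj: "inj_on (\<lambda>x. x ^ 3) (U m1)"
    by (rule inj_on_power_coprime[OF cop]) (auto simp: roots_of_unity_in_eq[OF m1])
  have sub: "(\<lambda>x. x ^ 3) ` U m1 \<subseteq> U m1"
    using U_mult[OF m1] by (auto simp: power3_eq_cube)
  have "bij_betw (\<lambda>x. x ^ 3) (U m1) (U m1)"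
    unfolding bij_betw_def using inj card_subset_eq[OF finite sub] by (simp add: card_image)
  from bij_betw_DiffI[OF this, of "{1}" "{1}"] show ?thesis
    using U_1[OF m1] by (auto simp: bij_betw_def)
qed

text \<open>
  Writing $x^3 + x^{-3} = D_3(x + x^{-1})$ with $D_3(t) = t^3 + t$, the sums over the split torus
  $\mathbb{F}_{2^{m_1}}^*$ and the nonsplit torus $U_1$ add up to $2C$; on $U_1$ cubing is a
  permutation, which turns the second sum into a Kloosterman sum.
\<close>

lemma sum_tr_chi_cube_add_inverse:
  assumes c: "c \<in> F1"
  shows "(\<Sum>x\<in>F1. tr_chi m1 (c * (x ^ 3 + inverse (x ^ 3))))
    = 2 * cubic_sum m1 c c + kloosterman_sum m1 c - 1"
proof -
  define h where "h t = tr_chi m1 (c * (t ^ 3 + t))" for t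
  have h: "tr_chi m1 (c * (x ^ 3 + inverse (x ^ 3))) = h (x + inverse x)" if "x \<noteq> 0" for x
    unfolding h_def cube_add_inverse[OF that, symmetric] by (simp add: power_inverse)
  have "(\<Sum>x\<in>F1. tr_chi m1 (c * (x ^ 3 + inverse (x ^ 3)))) = (\<Sum>x\<in>F1. h (x + inverse x))"
    by (intro sum.cong) (auto simp: h GF2_star_iff)
  \<comment> \<open>The torus parametrisation omits t = 0, that is x = 1, so this term is split
    off.\<close>
  also have "\<dots> = h 0 + (\<Sum>x\<in>F1 - {1}. h (x + inverse x))"
    by (subst sum.remove[of _ 1]) (auto simp: GF2_star_iff)
  also have "h 0 = 1" by (simp add: h_def)
  finally have split: "(\<Sum>x\<in>F1. tr_chi m1 (c * (x ^ 3 + inverse (x ^ 3))))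
      = 1 + (\<Sum>t\<in>F1. (1 + tr_chi m1 (inverse t)) * h t)"
    by (simp add: sum_GF2_star_add_inverse[OF m1])
  have "(\<Sum>t\<in>F1. (1 - tr_chi m1 (inverse t)) * h t) = (\<Sum>x\<in>U m1 - {1}. h (x + inverse x))"
    by (simp add: sum_U_add_inverse[OF m1])
  also have "\<dots> = (\<Sum>x\<in>U m1 - {1}. tr_chi m1 (c * (x ^ 3 + inverse (x ^ 3))))"
    by (intro sum.cong) (auto simp: h U_nonzero[OF m1])
  also have "\<dots> = (\<Sum>x\<in>U m1 - {1}. tr_chi m1 (c * (x + inverse x)))"
    by (rule sum.reindex_bij_betw[OF U_cube_bij])
  also have "\<dots> = (\<Sum>t\<in>F1. (1 - tr_chi m1 (inverse t)) * tr_chi m1 (c * t))"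
    by (rule sum_U_add_inverse[OF m1])
  also have "\<dots> = (\<Sum>t\<in>F1. tr_chi m1 (c * t) - tr_chi m1 (c * t + inverse t))"
    using c by (intro sum.cong) (auto simp: tr_chi_add GF2_star_iff GF2_mult GF2_inverse algebra_simps)
  also have "\<dots> = - kloosterman_sum m1 c"
    using c m1 by (simp add: sum_subtractf kloosterman_sum_eq sum_tr_chi_mult_star GF2_star_iff)
  finally have "(\<Sum>t\<in>F1. (1 - tr_chi m1 (inverse t)) * h t) = - kloosterman_sum m1 c" .
  moreover have "(\<Sum>t\<in>F1. (1 + tr_chi m1 (inverse t)) * h t) + (\<Sum>t\<in>F1. (1 - tr_chi m1 (inverse t)) * h t)
      = 2 * (\<Sum>t\<in>F1. h t)"
    by (simp add: sum_distrib_left algebra_simps flip: sum.distrib)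
  ultimately show ?thesis using split by (simp add: cubic_sum_eq h_def)
qed

section \<open>Kloosterman sums over cubic classes\<close>

text \<open>The share of one coset of the cubes in a Kloosterman sum. With c as the square root of
  a, the argument becomes symmetric under inversion of s.\<close>

definition kloosterman_class_sum :: "'a \<Rightarrow> 'a \<Rightarrow> real" where
  "kloosterman_class_sum c \<beta> = (\<Sum>s | s \<in> F1 \<and> psi m1 s = \<beta>. tr_chi m1 (c * (s + inverse s)))"

lemma kloosterman_class_sum_inverse: "kloosterman_class_sum c (inverse \<beta>) = kloosterman_class_sum c \<beta>"
proof -
  have "bij_betw inverse {s. s \<in> F1 \<and> psi m1 s = \<beta>} {s. s \<in> F1 \<and> psi m1 s = inverse \<beta>}"
    by (rule bij_betw_byWitness[where f' = inverse])
      (auto simp: GF2_star_iff psi_inverse intro: GF2_inverse)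
  from sum.reindex_bij_betw[OF this, of "\<lambda>s. tr_chi m1 (c * (s + inverse s))"]
  show ?thesis by (simp add: kloosterman_class_sum_def add.commute)
qed

lemma sum_F1_scale:
  fixes g :: "'a \<Rightarrow> real"
  assumes c: "c \<in> F1"
  shows "(\<Sum>s | s \<in> F1 \<and> psi m1 s = \<beta>. g (c * s)) = (\<Sum>s | s \<in> F1 \<and> psi m1 s = psi m1 c * \<beta>. g s)"
proof -
  have nz: "psi m1 c \<noteq> 0" "c \<noteq> 0" using psi_cube[OF c] c by (auto simp: GF2_star_iff)
  have "bij_betw (\<lambda>s. c * s) {s. s \<in> F1 \<and> psi m1 s = \<beta>} {s. s \<in> F1 \<and> psi m1 s = psi m1 c * \<beta>}"
    by (rule bij_betw_byWitness[where f' = "\<lambda>s. inverse c * s"])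
      (use c nz in \<open>auto simp: GF2_star_iff psi_mult psi_inverse intro!: GF2_mult GF2_inverse\<close>)
  then show ?thesis by (rule sum.reindex_bij_betw)
qed

lemma scale_add_inverse:
  assumes "c \<in> F1" "a = c\<^sup>2"
  shows "c * (c * s + inverse (c * s)) = a * s + inverse s"
proof -
  have "c * inverse (c * s) = inverse s"
    using assms by (simp add: GF2_star_iff flip: mult.assoc)
  then show ?thesis using assms by (simp add: power2_eq_square distrib_left mult.assoc)
qed

text \<open>Substituting c s for s gives the symmetric form and shifts the class by
  \<open>psi m1 c\<close>, which is the inverse of \<open>psi m1 a\<close> because psi(a) = psi(c)^2
  and psi(c)^3 = 1.\<close>

lemma kloosterman_class_sum_scale:
  assumes c: "c \<in> F1" and a: "a = c\<^sup>2"
  shows "(\<Sum>s | s \<in> F1 \<and> psi m1 s = \<beta>. tr_chi m1 (a * s + inverse s)) = kloosterman_class_sum c (inverse (psi m1 a) * \<beta>)"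
proof -
  have "inverse (psi m1 a) = psi m1 c"
    using cube_root_of_unity_inverse[OF psi_cube[OF c]] by (simp add: a psi_power)
  moreover note scale_add_inverse[OF assms]
  ultimately show ?thesis
    using sum_F1_scale[OF c, of "\<lambda>s. tr_chi m1 (c * (s + inverse s))" \<beta>]
    by (simp add: kloosterman_class_sum_def del: inverse_mult_distrib)
qed

text \<open>The listed values are three distinct cube roots of unity, hence all of them; inversion
  swaps the last two.\<close>

lemma sum_psi_classes:
  fixes g :: "'a \<Rightarrow> real"
  assumes "\<beta> ^ 3 = 1" "\<beta> \<noteq> 1"
  shows "(\<Sum>s\<in>F1. g s) = (\<Sum>z\<in>{1, \<beta>, inverse \<beta>}. \<Sum>s | s \<in> F1 \<and> psi m1 s = z. g s)"
    and "distinct [1, \<beta>, inverse \<beta>]"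
proof -
  have nz: "\<beta> \<noteq> 0" using assms by auto
  show dist: "distinct [1, \<beta>, inverse \<beta>]"
    using inverse_eq_self[of \<beta>] assms nz by auto
  have "{1, \<beta>, inverse \<beta>} \<subseteq> {z. z ^ 3 = 1}" using assms by (auto simp: power_inverse)
  moreover have "card {z::'a. z ^ 3 = 1} \<le> card {1, \<beta>, inverse \<beta>}"
    using card_power_eq_le(2)[of 3 "1::'a"] dist by simp
  ultimately have eq: "{1, \<beta>, inverse \<beta>} = {z. z ^ 3 = 1}"
    by (intro card_seteq) auto
  show "(\<Sum>s\<in>F1. g s) = (\<Sum>z\<in>{1, \<beta>, inverse \<beta>}. \<Sum>s | s \<in> F1 \<and> psi m1 s = z. g s)"
    unfolding eq by (rule sum.group[symmetric]) (auto simp: psi_cube)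
qed

text \<open>The class of 1 is a third of the sum over all cubes x^3. The three classes add up to K -
  1, and the other two are equal, so each is half of the rest.\<close>

lemma kloosterman_class_sum_eq:
  assumes c: "c \<in> F1" and a: "a = c\<^sup>2" and \<beta>: "\<beta> ^ 3 = 1"
  shows "kloosterman_class_sum c \<beta> = (kloosterman_sum m1 a - 1
    + (if \<beta> = 1 then 2 * cubic_sum m1 a a else - cubic_sum m1 a a)) / 3"
proof -
  have 1: "kloosterman_class_sum c 1 = (kloosterman_sum m1 a - 1 + 2 * cubic_sum m1 a a) / 3"
    using sum_cubes[of "\<lambda>s. tr_chi m1 (c * (s + inverse s))"] sum_tr_chi_cube_add_inverse[OF c]
      kloosterman_sum_square[OF c] cubic_sum_square[OF c]
    by (simp add: kloosterman_class_sum_def a)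
  show ?thesis
  proof (cases "\<beta> = 1")
    case True
    then show ?thesis using 1 by simp
  next
    case False
    note cl = sum_psi_classes[OF \<beta> False]
    have "bij_betw (\<lambda>s. c * s) F1 F1" by (rule GF2_star_mult_bij[OF c])
    from sum.reindex_bij_betw[OF this, of "\<lambda>s. tr_chi m1 (c * (s + inverse s))"]
    have "(\<Sum>s\<in>F1. tr_chi m1 (c * (s + inverse s))) = (\<Sum>s\<in>F1. tr_chi m1 (a * s + inverse s))"
      by (simp add: scale_add_inverse[OF c a] del: inverse_mult_distrib)
    also have "\<dots> = kloosterman_sum m1 a - 1" by (simp add: kloosterman_sum_eq)
    finally have "kloosterman_sum m1 a - 1 = kloosterman_class_sum c 1 + kloosterman_class_sum c \<beta> + kloosterman_class_sum c (inverse \<beta>)"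
      using cl(1)[of "\<lambda>s. tr_chi m1 (c * (s + inverse s))"] cl(2) by (simp add: kloosterman_class_sum_def)
    then have "2 * kloosterman_class_sum c \<beta> = kloosterman_sum m1 a - 1 - kloosterman_class_sum c 1"
      by (simp add: kloosterman_class_sum_inverse)
    then show ?thesis using 1 False by (simp add: field_simps)
  qed
qed

subsection \<open>Evaluation of the sum\<close>

text \<open>Here psi(x) for the large field is the (2^m1 + 1)-th power of \<open>psi m1 x\<close>;
  this exponent is 2 modulo 3, and squaring inverts a cube root of unity.\<close>

lemma psi_double:
  assumes "x \<in> F1"
  shows "psi (2 * m1) x = inverse (psi m1 x)"
proof -
  let ?e = "d * (2 ^ m2 - 1)"
  have "(2::nat) ^ (2 * m1) - 1 = 3 * (?e * (2 ^ m1 + 1))"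
    using two_power_double_minus_1[of m1] two_power_m1 by simp
  then have "psi (2 * m1) x = psi m1 x ^ (2 ^ m1 + 1)"
    unfolding psi_def psi_exponent by (metis nonzero_mult_div_cancel_left power_mult zero_neq_numeral)
  moreover have "(2 ^ m1 + 1) mod 3 = (2::nat)"
  proof -
    have "(2::nat) ^ m1 + 1 = 3 * ?e + 2"
      using two_power_m1 one_le_power[of "2::nat" m1] by linarith
    moreover have "(3 * k + 2) mod 3 = (2::nat)" for k by presburger
    ultimately show ?thesis by metis
  qed
  ultimately show ?thesis
    using cube_root_of_unity_power[OF psi_cube[OF assms], of "2 ^ m1 + 1"]
      cube_root_of_unity_inverse[OF psi_cube[OF assms]] by simp
qed

section \<open>Relative traces and the trace conditions\<close>

lemma rel_trace_m1: "rel_trace m1 (2 * m1) x = x + (x::'a) ^ (2 ^ m1)"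
  using m1 by (simp add: rel_trace_def lessThan_nat_numeral lessThan_Suc numeral_2_eq_2)

text \<open>Transitivity of the trace. Hence the smaller trace vanishes exactly when the larger one
  lies in \<open>GF2 m2\<close>.\<close>

lemma rel_trace_m2:
  "rel_trace m2 (2 * m1) x = rel_trace m1 (2 * m1) x + (rel_trace m1 (2 * m1) (x::'a)) ^ (2 ^ m2)"
proof -
  have "2 * m1 div m2 = 4" using m2 m1_eq by simp
  moreover have "{..<4::nat} = {0, 1, 2, 3}" by auto
  ultimately have "rel_trace m2 (2 * m1) x
      = x + x ^ (2 ^ m2) + x ^ (2 ^ (m2 * 2)) + x ^ (2 ^ (m2 * 3))"
    by (simp add: rel_trace_def add.assoc)
  moreover have "(x ^ 2 ^ m1) ^ 2 ^ m2 = x ^ (2 ^ (m2 * 3))"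
    by (simp add: m1_eq mult.commute[of m2] flip: power_mult power_add)
  ultimately show ?thesis
    unfolding rel_trace_m1 frobenius_add by (simp add: m1_eq ac_simps)
qed

lemma add_inverse_U_in_F1:
  assumes "x \<in> U m1" "x \<noteq> 1"
  shows "x + inverse x \<in> F1"
  using add_inverse_split(2)[OF m1] assms by blast

lemma U_inter_GF2: "v \<in> U m2 \<Longrightarrow> v \<in> GF2 m2 \<Longrightarrow> v = 1"
  using U_frobenius[OF m2] inverse_eq_self[of v] U_nonzero[OF m2] by (auto simp: GF2_def)

text \<open>The factors \<open>u2\<close>, \<open>w2\<close> and \<open>y\<close> lie in
  \<open>GF2 m1\<close> and come out of the trace; only \<open>u1\<close> is conjugated.\<close>

lemma rel_trace_m1_product:
  assumes u1: "u1 \<in> U m1" and u2: "u2 \<in> U m2" and w2: "w2 \<in> U m2" and y: "y \<in> GF2_star m2"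
  shows "rel_trace m1 (2 * m1) (u1 * u2 * (w2 * y)) = (u1 + inverse u1) * (u2 * (w2 * y))"
proof -
  have U2: "x ^ (2 ^ m1) = x" if "x \<in> U m2" for x
    using that by (simp add: roots_of_unity_in_def GF2_star_iff GF2_def m1_eq)
  have y': "y ^ (2 ^ m1) = y"
    using y by (simp add: m1_eq mult_2 power_add power_mult GF2_star_iff GF2_def)
  show ?thesis
    using u1 u2 w2 y'
    by (simp add: rel_trace_m1 power_mult_distrib U2 U_frobenius[OF m1] distrib_right mult.assoc)
qed

text \<open>
  Since $u_1^{2^{m_1}} = u_1^{-1}$, the two trace conditions say that $t = u_1 + u_1^{-1}$ is nonzero
  and that $u_2 \omega t \in \mathbb{F}_{2^{m_2}}$. Hence $u_2 w_2$ is the inverse of the $U_2$-component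
  of $t$.
\<close>

lemma S2_condition:
  assumes u1: "u1 \<in> U m1" and u2: "u2 \<in> U m2" and w2: "w2 \<in> U m2" and y: "y \<in> GF2_star m2"
    and v: "v \<in> U m2" and r: "r \<in> GF2_star m2" and t: "u1 + inverse u1 = v * r"
  shows "rel_trace m1 (2 * m1) (u1 * u2 * (w2 * y)) \<noteq> 0
    \<and> rel_trace m2 (2 * m1) (u1 * u2 * (w2 * y)) = 0 \<longleftrightarrow> u2 = inverse (w2 * v)"
proof -
  have nz: "w2 \<noteq> 0" "v \<noteq> 0" "y \<noteq> 0" "r \<noteq> 0" "u2 \<noteq> 0"
    using w2 v y r u2 U_nonzero[OF m2] by (auto simp: GF2_star_iff)
  let ?z = "rel_trace m1 (2 * m1) (u1 * u2 * (w2 * y))"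
  have "?z = (u1 + inverse u1) * (u2 * (w2 * y))"
    using u1 u2 w2 y by (rule rel_trace_m1_product)
  also have "\<dots> = (u2 * w2 * v) * (y * r)" unfolding t by (simp add: ac_simps)
  finally have z: "?z = (u2 * w2 * v) * (y * r)" .
  have yr: "(y * r) ^ (2 ^ m2) = y * r"
    using y r by (simp add: power_mult_distrib GF2_star_iff GF2_def)
  have "rel_trace m2 (2 * m1) (u1 * u2 * (w2 * y)) = 0 \<longleftrightarrow> ?z ^ (2 ^ m2) = ?z"
    unfolding rel_trace_m2 by auto
  also have "\<dots> \<longleftrightarrow> (u2 * w2 * v) ^ (2 ^ m2) = u2 * w2 * v"
    unfolding z power_mult_distrib[of "u2 * w2 * v"] yr using nz by simp
  also have "\<dots> \<longleftrightarrow> u2 * w2 * v = 1"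
    using U_inter_GF2[of "u2 * w2 * v"] U_mult[OF m2] u2 w2 v by (auto simp: GF2_def)
  also have "\<dots> \<longleftrightarrow> u2 = inverse (w2 * v)"
    using nz by (simp add: field_simps)
  finally show ?thesis using z nz by simp
qed

text \<open>The power of \<open>u1\<close> is u1^-2, with conjugate u1^2, so the trace to
  \<open>GF2 m1\<close> is a(u1^2 + u1^-2) = a t^2.\<close>

lemma S2_summand:
  assumes u1: "u1 \<in> U m1" and a: "a \<in> F1"
  shows "chi (abs_trace (2 * m1) (a * u1 ^ (2 ^ m1 - 1))) = tr_chi m1 (a * (u1 + inverse u1)\<^sup>2)"
proof -
  have nz: "u1 \<noteq> 0" using u1 U_nonzero[OF m1] by blast
  have "u1 ^ (2 ^ m1) = u1 * u1 ^ (2 ^ m1 - 1)" by (subst power_Suc[symmetric]) simp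
  then have "u1 ^ (2 ^ m1 - 1) = inverse u1 ^ 2"
    using U_frobenius[OF m1 u1] nz by (simp add: field_simps power2_eq_square)
  moreover have "(a * inverse u1 ^ 2) ^ (2 ^ m1) = a * u1 ^ 2"
  proof -
    have "(inverse u1 ^ 2) ^ (2 ^ m1) = (inverse (u1 ^ (2 ^ m1))) ^ 2"
      by (simp add: power_inverse mult.commute flip: power_mult)
    also have "\<dots> = u1 ^ 2" by (simp add: U_frobenius[OF m1 u1])
    finally show ?thesis using a by (simp add: power_mult_distrib GF2_star_iff GF2_def)
  qed
  ultimately show ?thesis
    by (simp add: abs_trace_double tr_chi_def square_add distrib_left add.commute)
qed

section \<open>Reduction to sums over a cubic class\<close>

text \<open>Projection to \<open>u1\<close> is injective on the index set: the polar form of t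
  determines \<open>u2\<close>, and what remains is a condition on \<open>u1\<close> alone.\<close>

lemma S2_eq_sum_U:
  assumes a: "a \<in> F1" and w2: "w2 \<in> U m2" and y: "y \<in> GF2_star m2"
  shows "S2 (2 * m1) m1 m2 a b (w2 * y) =
    (\<Sum>u1\<in>U m1 - {1}. if b * psi m1 w2 * psi m1 (u1 + inverse u1) = 1
       then tr_chi m1 (a * (u1 + inverse u1)\<^sup>2) else 0)"
proof -
  define P where "P = {(u1, u2). u1 \<in> U m1 \<and> u2 \<in> roots_of_unity_in m1 (2 ^ m2 + 1) \<and>
    rel_trace m1 (2 * m1) (u1 * u2 * (w2 * y)) \<noteq> 0 \<and>
    rel_trace m2 (2 * m1) (u1 * u2 * (w2 * y)) = 0 \<and> b * psi (2 * m1) u2 = 1}"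
  define A where "A = {u1 \<in> U m1 - {1}. b * psi m1 w2 * psi m1 (u1 + inverse u1) = 1}"
  have Um2: "roots_of_unity_in m1 (2 ^ m2 + 1) = U m2" by (simp add: m1_eq)
  have iff: "(u1, u2) \<in> P \<longleftrightarrow> u1 \<in> A \<and> u2 = inverse (w2 * v)"
    if h: "u1 \<in> U m1" "v \<in> U m2" "r \<in> GF2_star m2" "u1 + inverse u1 = v * r" for u1 u2 v r
  proof -
    have "v \<noteq> 0" "r \<noteq> 0" using h U_nonzero[OF m2] by (auto simp: GF2_star_iff)
    then have "u1 \<noteq> 1" using h by auto
    have mem: "inverse (w2 * v) \<in> U m2" using h w2 by (intro U_inverse[OF m2] U_mult[OF m2])
    then have "inverse (w2 * v) \<in> F1" by (simp add: roots_of_unity_in_def m1_eq)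
    then have "psi (2 * m1) (inverse (w2 * v)) = inverse (psi m1 (inverse (w2 * v)))"
      by (rule psi_double)
    \<comment> \<open>The inversion in \<open>u2\<close> cancels the one caused by passing from
      \<open>m1\<close> to \<open>2 * m1\<close>.\<close>
    then have "psi (2 * m1) (inverse (w2 * v)) = psi m1 w2 * psi m1 v"
      by (simp only: psi_inverse psi_mult inverse_inverse_eq)
    moreover have "psi m1 (u1 + inverse u1) = psi m1 v"
      using h by (simp add: psi_mult psi_GF2_star_m2)
    ultimately show ?thesis
      using h S2_condition[OF h(1) _ w2 y h(2,3,4), of u2] mem \<open>u1 \<noteq> 1\<close> unfolding P_def A_def Um2
      by (auto simp: mult.assoc)
  qed
  have polar: "\<exists>v r. v \<in> U m2 \<and> r \<in> GF2_star m2 \<and> u1 + inverse u1 = v * r"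
    if "u1 \<in> U m1" "u1 \<noteq> 1" for u1
  proof -
    have "u1 + inverse u1 \<in> (\<lambda>(v, r). v * r) ` (U m2 \<times> GF2_star m2)"
      using add_inverse_U_in_F1[OF that] bij_betw_imp_surj_on[OF polar_F1] by simp
    then show ?thesis by auto
  qed
  have P_polar: "\<exists>v r. v \<in> U m2 \<and> r \<in> GF2_star m2 \<and> u1 + inverse u1 = v * r \<and> u1 \<in> U m1"
    if p: "(u1, u2) \<in> P" for u1 u2
  proof -
    have u: "u1 \<in> U m1" "u2 \<in> U m2" "rel_trace m1 (2 * m1) (u1 * u2 * (w2 * y)) \<noteq> 0"
      using p unfolding P_def Um2 by auto
    \<comment> \<open>For \<open>u1 = 1\<close> the factor t = 0 would make the first trace
      vanish.\<close>
    then have "u1 \<noteq> 1" using rel_trace_m1_product[OF u(1,2) w2 y] by auto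
    then show ?thesis using polar u(1) by blast
  qed
  have "bij_betw fst P A"
    unfolding bij_betw_def
  proof
    have "u2 = u2'" if p: "(u1, u2) \<in> P" "(u1, u2') \<in> P" for u1 u2 u2'
    proof -
      obtain v r where h: "v \<in> U m2" "r \<in> GF2_star m2" "u1 + inverse u1 = v * r" "u1 \<in> U m1"
        using P_polar[OF p(1)] by blast
      show ?thesis using iff[OF h(4,1-3)] p by simp
    qed
    then show "inj_on fst P" unfolding inj_on_def by auto
    show "fst ` P = A"
    proof (intro subset_antisym subsetI)
      fix u1 assume "u1 \<in> fst ` P"
      then obtain u2 where p: "(u1, u2) \<in> P" by auto
      obtain v r where h: "v \<in> U m2" "r \<in> GF2_star m2" "u1 + inverse u1 = v * r" "u1 \<in> U m1"
        using P_polar[OF p] by blast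
      show "u1 \<in> A" using iff[OF h(4,1-3)] p by simp
    next
      fix u1 assume u1: "u1 \<in> A"
      then have u1': "u1 \<in> U m1" "u1 \<noteq> 1" by (auto simp: A_def)
      then obtain v r where h: "v \<in> U m2" "r \<in> GF2_star m2" "u1 + inverse u1 = v * r"
        using polar by blast
      then have "(u1, inverse (w2 * v)) \<in> P" using u1 iff[OF u1'(1) h] by simp
      then show "u1 \<in> fst ` P" by (rule rev_image_eqI) simp
    qed
  qed
  then have "(\<Sum>p\<in>P. chi (abs_trace (2 * m1) (a * fst p ^ (2 ^ m1 - 1))))
      = (\<Sum>u1\<in>A. chi (abs_trace (2 * m1) (a * u1 ^ (2 ^ m1 - 1))))"
    by (rule sum.reindex_bij_betw)
  also have "\<dots> = (\<Sum>u1\<in>A. tr_chi m1 (a * (u1 + inverse u1)\<^sup>2))"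
    using a by (intro sum.cong) (auto simp: A_def S2_summand)
  also have "\<dots> = (\<Sum>u1\<in>U m1 - {1}. if b * psi m1 w2 * psi m1 (u1 + inverse u1) = 1
       then tr_chi m1 (a * (u1 + inverse u1)\<^sup>2) else 0)"
    unfolding A_def by (subst sum.inter_filter) auto
  finally show ?thesis by (simp add: P_def S2_def case_prod_unfold)
qed

lemma S2_eq:
  assumes a: "a \<in> F1" and w2: "w2 \<in> U m2" and y: "y \<in> GF2_star m2"
    and \<gamma>: "\<gamma> = b * psi m1 w2" "\<gamma> ^ 3 = 1"
  shows "S2 (2 * m1) m1 m2 a b (w2 * y) =
    (\<Sum>s | s \<in> F1 \<and> psi m1 s = \<gamma>. tr_chi m1 (a * s)) - (\<Sum>s | s \<in> F1 \<and> psi m1 s = \<gamma>. tr_chi m1 (a * s + inverse s))"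
proof -
  have "S2 (2 * m1) m1 m2 a b (w2 * y)
      = (\<Sum>t\<in>F1. (1 - tr_chi m1 (inverse t)) * (if \<gamma> * psi m1 t = 1 then tr_chi m1 (a * t\<^sup>2) else 0))"
    unfolding S2_eq_sum_U[OF a w2 y] \<gamma>(1)[symmetric] by (rule sum_U_add_inverse[OF m1])
  \<comment> \<open>Everything is expressed through t^2, so that squaring can be undone next. The
    trace is Frobenius invariant, and psi(t^2) = psi(t)^-1 turns the condition into psi(t^2) =
    \<gamma>.\<close>
  also have "\<dots> = (\<Sum>t\<in>F1. (1 - tr_chi m1 (inverse (t\<^sup>2))) * (if psi m1 (t\<^sup>2) = \<gamma> then tr_chi m1 (a * t\<^sup>2) else 0))"
  proof (rule sum.cong)
    fix t assume t: "t \<in> F1"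
    have "tr_chi m1 (inverse (t\<^sup>2)) = tr_chi m1 (inverse t)"
      using t tr_chi_square[of "inverse t" m1] by (simp add: power_inverse GF2_star_iff GF2_inverse)
    moreover have "\<gamma> * psi m1 t = 1 \<longleftrightarrow> psi m1 (t\<^sup>2) = \<gamma>"
    proof -
      have "psi m1 t \<noteq> 0" using psi_cube[OF t] by auto
      then have "\<gamma> * psi m1 t = 1 \<longleftrightarrow> inverse (psi m1 t) = \<gamma>" by (auto simp: field_simps)
      then show ?thesis
        using cube_root_of_unity_inverse[OF psi_cube[OF t]] by (simp add: psi_power)
    qed
    ultimately show "(1 - tr_chi m1 (inverse t)) * (if \<gamma> * psi m1 t = 1 then tr_chi m1 (a * t\<^sup>2) else 0) =
        (1 - tr_chi m1 (inverse (t\<^sup>2))) * (if psi m1 (t\<^sup>2) = \<gamma> then tr_chi m1 (a * t\<^sup>2) else 0)"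
      by simp
  qed simp
  also have "\<dots> = (\<Sum>s\<in>F1. (1 - tr_chi m1 (inverse s)) * (if psi m1 s = \<gamma> then tr_chi m1 (a * s) else 0))"
    by (rule sum.reindex_bij_betw[OF GF2_star_square_bij])
  also have "\<dots> = (\<Sum>s\<in>F1. if psi m1 s = \<gamma> then tr_chi m1 (a * s) - tr_chi m1 (a * s + inverse s) else 0)"
    using a by (intro sum.cong)
      (auto simp: tr_chi_add GF2_star_iff GF2_mult GF2_inverse algebra_simps)
  also have "\<dots> = (\<Sum>s | s \<in> F1 \<and> psi m1 s = \<gamma>. tr_chi m1 (a * s) - tr_chi m1 (a * s + inverse s))"
    by (simp add: sum.inter_filter)
  finally show ?thesis by (simp add: sum_subtractf)
qed

text \<open>Scaling moves the Gauss period to the class \<alpha>\<gamma> and the Kloosterman part to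
  the class \<gamma>/\<alpha>. The special cases of the two evaluations are therefore \<gamma> =
  \<alpha>^-1 and \<gamma> = \<alpha>, and they act independently.\<close>

lemma S2_value:
  assumes a: "a \<in> F1" and w2: "w2 \<in> U m2" and y: "y \<in> GF2_star m2" and b: "b \<in> GF2_star 2"
    and \<gamma>: "\<gamma> = b * psi m1 w2" and \<alpha>: "\<alpha> = psi m1 a"
  shows "S2 (2 * m1) m1 m2 a b (w2 * y) =
    ((if \<gamma> = inverse \<alpha> then 2 ^ (m2 + 1) else - (2 ^ m2))
     + (if \<gamma> = \<alpha> then - 2 * cubic_sum m1 a a else cubic_sum m1 a a) - kloosterman_sum m1 a) / 3"
proof -
  have \<alpha>3: "\<alpha> ^ 3 = 1" using psi_cube[OF a] \<alpha> by simp
  have "w2 \<in> F1" using w2 by (simp add: roots_of_unity_in_def m1_eq)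
  moreover have "b ^ 3 = 1" using b GF2_star_eq[of 2] by simp
  ultimately have \<gamma>3: "\<gamma> ^ 3 = 1" using psi_cube by (simp add: \<gamma> power_mult_distrib)
  have nz: "\<alpha> \<noteq> 0" "\<gamma> \<noteq> 0" using \<alpha>3 \<gamma>3 by auto
  obtain c where c: "c \<in> F1" "a = c\<^sup>2"
    using GF2_star_square_bij[of m1] a unfolding bij_betw_def by blast
  have "(\<Sum>s | s \<in> F1 \<and> psi m1 s = \<gamma>. tr_chi m1 (a * s)) = (\<Sum>s | s \<in> F1 \<and> psi m1 s = \<alpha> * \<gamma>. tr_chi m1 s)"
    unfolding \<alpha> by (rule sum_F1_scale[OF a])
  also have "\<dots> = (if \<alpha> * \<gamma> = 1 then 2 ^ m2 else 0) - (2 ^ m2 + 1) / 3"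
    using \<alpha>3 \<gamma>3 by (intro cubic_gauss_period) (simp add: power_mult_distrib)
  finally have 1: "(\<Sum>s | s \<in> F1 \<and> psi m1 s = \<gamma>. tr_chi m1 (a * s))
    = (if \<gamma> = inverse \<alpha> then 2 ^ m2 else 0) - (2 ^ m2 + 1) / 3"
    using nz by (simp add: field_simps)
  have "(\<Sum>s | s \<in> F1 \<and> psi m1 s = \<gamma>. tr_chi m1 (a * s + inverse s)) = kloosterman_class_sum c (inverse \<alpha> * \<gamma>)"
    unfolding \<alpha> by (rule kloosterman_class_sum_scale[OF c])
  also have "\<dots> = (kloosterman_sum m1 a - 1
    + (if inverse \<alpha> * \<gamma> = 1 then 2 * cubic_sum m1 a a else - cubic_sum m1 a a)) / 3"
    using \<alpha>3 \<gamma>3 by (intro kloosterman_class_sum_eq[OF c]) (simp add: power_mult_distrib power_inverse)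
  finally have 2: "(\<Sum>s | s \<in> F1 \<and> psi m1 s = \<gamma>. tr_chi m1 (a * s + inverse s))
    = (kloosterman_sum m1 a - 1 + (if \<gamma> = \<alpha> then 2 * cubic_sum m1 a a else - cubic_sum m1 a a)) / 3"
    using nz by (simp add: field_simps)
  \<comment> \<open>The 1/3 from K - 1 cancels the one in (2^m2 + 1)/3, and 2^m2 - 2^m2/3 becomes
    2^(m2+1)/3.\<close>
  show ?thesis
    unfolding S2_eq[OF a w2 y \<gamma> \<gamma>3] 1 2 by (simp add: field_simps power_add)
qed

end

theorem mainTheorem10:
  fixes a b \<omega> w2 y \<gamma> \<alpha> :: "'a::finite_field"
    and n m0 m1 m2 :: nat
  assumes "odd m2"
    and "n = 4 * m2"
    and "m1 = 2 * m2"
    and "m0 = n"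
    and "card (UNIV :: 'a set) = 2 ^ m0"
    and "a \<in> GF2_star m1"
    and "b \<in> GF2_star 2"
    and "\<omega> \<in> GF2_star m1"
    and "\<omega> = w2 * y"
    and "w2 \<in> roots_of_unity_in m1 (2 ^ m2 + 1)"
    and "y \<in> GF2_star m2"
    and "\<gamma> = b * psi m1 w2"
    and "\<alpha> = psi m1 a"
  shows "S2 m0 m1 m2 a b \<omega> =
    (if \<gamma> = \<alpha> \<and> \<gamma> = inverse \<alpha> then
       1 / 3 * (2 ^ (m2 + 1) - 2 * cubic_sum m1 a a - kloosterman_sum m1 a)
     else if \<gamma> = \<alpha> \<and> \<gamma> \<noteq> inverse \<alpha> then
       1 / 3 * (- (2 ^ m2) - 2 * cubic_sum m1 a a - kloosterman_sum m1 a)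
     else if \<gamma> \<noteq> \<alpha> \<and> \<gamma> = inverse \<alpha> then
       1 / 3 * (2 ^ (m2 + 1) + cubic_sum m1 a a - kloosterman_sum m1 a)
     else
       1 / 3 * (- (2 ^ m2) + cubic_sum m1 a a - kloosterman_sum m1 a))"
proof -
  have m0: "m0 = 2 * m1" using assms(2-4) by simp
  interpret gf2_tower m1 "TYPE('a)" m2
    by unfold_locales (use assms m0 in auto)
  have w2: "w2 \<in> roots_of_unity_in (2 * m2) (2 ^ m2 + 1)" using assms(3,10) by simp
  show ?thesis
    unfolding m0 \<open>\<omega> = w2 * y\<close> S2_value[OF assms(6) w2 assms(11,7,12,13)]
    by simp
qed

end
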